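(* Let $\alpha>0$, let $F$ be a continuous distribution function of a positive random variable $X$, and let $R(x)=\sum_{n=0}^{\infty}F^{\boxtimes n}(x)$ be the Kendall renewal function of $F$. If $\overline{F}\in\Gamma(g)$, then $m(\sigma)=E(X^\sigma)<\infty$ for all $\sigma>0$, and consequently for every $y>0$ $$\lim_{x\to\infty}\frac{1}{x^{\alpha-1}}\bigl(R(x+y)-R(x)\bigr)=\frac{2\alpha}{m(\alpha)}\,y.$$
   Context: Fix $\alpha>0$. $X$ is a positive random variable with distribution function $F(x)=P(X\le x)$, $F(0-)=0$, $F$ continuous; $\overline{F}=1-F$; $m(\sigma)=\int_0^\infty y^\sigma\,dF(y)$ for $\sigma>0$. The Williamson transform ($G$-transform) of a distribution function $F$ with $F(0-)=0$ is $G_F(x)=\int_0^x\bigl(1-(t/x)^\alpha\bigr)\,dF(t)$, $x>0$. The Kendall convolution $F_1\boxtimes F_2$ of two distribution functions with $F_i(0-)=0$ is the distribution function $F_3$ (with $F_3(0-)=0$) determined by $G_{F_3}(x)=G_{F_1}(x)G_{F_2}(x)$. The $n$-fold Kendall convolution $F^{\boxtimes n}$ is thus the distribution function with $G$-transform $G_F^n$, and $F^{\boxtimes 0}$ is the distribution function of the point mass at $0$. A positive measurable function $f$ is in the class $\Gamma(g)$ with (positive, measurable) auxiliary function $g$ if $\lim_{x\to\infty}f(x+tg(x))/f(x)=e^{-t}$ for all real $t$; here $g$ is self-neglecting, i.e. $\lim_{x\to\infty}g(x+tg(x))/g(x)=1$ for all real $t$, and satisfies $\lim_{x\to\infty}g(x)/x=0$.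 *)

theory Defs
  imports "HOL-Probability.Probability"
begin

definition halfline_df :: "(real \<Rightarrow> real) \<Rightarrow> bool" where
  "halfline_df F \<longleftrightarrow>
     mono F \<and> (\<forall>a. continuous (at_right a) F) \<and> (\<forall>x<0. F x = 0) \<and> (F \<longlongrightarrow> 1) at_top"

text \<open>The range of integration is closed at \<open>0\<close>, so that an atom of \<open>F\<close> at the origin counts:
  the point mass at \<open>0\<close> has transform identically \<open>1\<close> (note that \<open>0 powr \<alpha> = 0\<close>).\<close>

definition williamson :: "real \<Rightarrow> (real \<Rightarrow> real) \<Rightarrow> real \<Rightarrow> real" where
  "williamson \<alpha> F x = (LINT t:{0..x}|interval_measure F. 1 - (t / x) powr \<alpha>)"

definition kendall_conv :: "real \<Rightarrow> (real \<Rightarrow> real) \<Rightarrow> (real \<Rightarrow> real) \<Rightarrow> real \<Rightarrow> real" where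
  "kendall_conv \<alpha> F\<^sub>1 F\<^sub>2 =
     (THE F\<^sub>3. halfline_df F\<^sub>3 \<and>
        (\<forall>x>0. williamson \<alpha> F\<^sub>3 x = williamson \<alpha> F\<^sub>1 x * williamson \<alpha> F\<^sub>2 x))"

fun kendall_power :: "real \<Rightarrow> (real \<Rightarrow> real) \<Rightarrow> nat \<Rightarrow> real \<Rightarrow> real" where
  "kendall_power \<alpha> F 0 = indicator {0..}"
| "kendall_power \<alpha> F (Suc n) = kendall_conv \<alpha> (kendall_power \<alpha> F n) F"

definition kendall_renewal :: "real \<Rightarrow> (real \<Rightarrow> real) \<Rightarrow> real \<Rightarrow> real" where
  "kendall_renewal \<alpha> F x = (\<Sum>n. kendall_power \<alpha> F n x)"

definition moment :: "(real \<Rightarrow> real) \<Rightarrow> real \<Rightarrow> ennreal" where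
  "moment F \<sigma> = (\<integral>\<^sup>+y\<in>{0..}. ennreal (y powr \<sigma>) \<partial>interval_measure F)"

definition self_neglecting :: "(real \<Rightarrow> real) \<Rightarrow> bool" where
  "self_neglecting g \<longleftrightarrow> (\<forall>t. ((\<lambda>x. g (x + t * g x) / g x) \<longlongrightarrow> 1) at_top)"

text \<open>Functions in the class and their auxiliary functions live on the positive half-line; their
  values elsewhere do not matter, since \<open>x + t * g x\<close> is eventually positive when \<open>g x / x\<close> tends
  to \<open>0\<close>.\<close>

definition gamma_class :: "(real \<Rightarrow> real) \<Rightarrow> (real \<Rightarrow> real) set" where
  "gamma_class g = {f.
     f \<in> borel_measurable (restrict_space borel {0<..}) \<and> (\<forall>x>0. f x > 0) \<and>
     g \<in> borel_measurable (restrict_space borel {0<..}) \<and> (\<forall>x>0. g x > 0) \<and>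
     self_neglecting g \<and> ((\<lambda>x. g x / x) \<longlongrightarrow> 0) at_top \<and>
     (\<forall>t. ((\<lambda>x. f (x + t * g x) / f x) \<longlongrightarrow> exp (- t)) at_top)}"

end

theory Submission
  imports Defs "HOL-Real_Asymp.Real_Asymp"
begin

text \<open>
  Let \<open>H x = E (min X x)\<^sup>\<alpha>\<close> be the truncated moment. The Williamson transform is
  \<open>G x = 1 - H x / x\<^sup>\<alpha>\<close> (lemma \<open>williamson_eq\<close>). For \<open>x \<le> y\<close>, the increment of \<open>H\<close> lies between
  \<open>(y\<^sup>\<alpha> - x\<^sup>\<alpha>) (1 - F y)\<close> and \<open>(y\<^sup>\<alpha> - x\<^sup>\<alpha>) (1 - F x)\<close> (\<open>trunc_moment_increment\<close>). Hence \<open>G\<close> determines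
  \<open>F\<close> (\<open>williamson_inject\<close>), and for continuous \<open>F\<close> the inversion formula \<open>F = G + x G' / \<alpha>\<close> holds.

  Applied to \<open>G\<^sup>n\<close>, the inversion formula yields \<open>G\<^sup>n + n G\<^bsup>n-1\<^esup> (F - G)\<close>. This is a distribution function
  with transform \<open>G\<^sup>n\<close>, so it is the \<open>n\<close>-fold Kendall convolution (\<open>kendall_power_Suc_eq\<close>). Summing the
  geometric series gives a closed form of the renewal function,
  \<open>R x = 2 / (1 - G x) - (1 - F x) / (1 - G x)\<^sup>2 = 2 x\<^sup>\<alpha> / H x - (1 - F x) x\<^bsup>2\<alpha>\<^esup> / (H x)\<^sup>2\<close>
  (\<open>kendall_renewal_eq\<close>), and the increments of \<open>R\<close> can be read off from those of \<open>H\<close>.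

  Membership of the tail in the class \<open>\<Gamma>(g)\<close> makes it decay faster than any power: since \<open>g x = o(x)\<close>,
  passing from \<open>x\<close> to \<open>2 x\<close> eventually multiplies the tail by a factor below any prescribed \<open>2\<^bsup>-s\<^esup>\<close>
  (\<open>gamma_class_doubling\<close>). Therefore all moments are finite, \<open>H x\<close> tends to \<open>m(\<alpha>)\<close>, the second term of \<open>R\<close> is
  negligible, and \<open>H (x + y) - H x\<close> is negligible as well. What remains is
  \<open>2 ((x + y)\<^sup>\<alpha> - x\<^sup>\<alpha>) / m(\<alpha>)\<close>, which is asymptotic to \<open>2 \<alpha> y x\<^bsup>\<alpha>-1\<^esup> / m(\<alpha>)\<close>
  (\<open>kendall_renewal_increment_tendsto\<close>).
\<close>

section \<open>Truncated moments and the Williamson transform\<close>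

text \<open>The truncated moment \<open>E (min X x)\<^sup>\<alpha>\<close> for the law of \<open>F\<close>. Clamping the integrand at \<open>0\<close> from below makes it
  monotone in \<open>t\<close> on the whole line, so that the support of \<open>F\<close> only has to be taken into account when
  comparing with the Williamson transform.\<close>

definition trunc_moment :: "real \<Rightarrow> (real \<Rightarrow> real) \<Rightarrow> real \<Rightarrow> real" where
  "trunc_moment \<alpha> F x = (LINT t|interval_measure F. max 0 (min t x) powr \<alpha>)"

lemma halfline_df_at_bot:
  assumes "halfline_df F"
  shows "(F \<longlongrightarrow> 0) at_bot"
proof (rule tendsto_eventually)
  show "\<forall>\<^sub>F x in at_bot. F x = 0"
    using assms by (auto simp: halfline_df_def eventually_at_bot_dense intro!: exI[of _ 0])
qed

lemma halfline_df_real_distribution: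
  assumes "halfline_df F"
  shows "real_distribution (interval_measure F)"
  using assms halfline_df_at_bot[OF assms]
  by (intro real_distribution_interval_measure) (auto simp: halfline_df_def mono_def)

lemma halfline_df_cdf:
  assumes "halfline_df F"
  shows "cdf (interval_measure F) = F"
  using assms halfline_df_at_bot[OF assms]
  by (intro cdf_interval_measure) (auto simp: halfline_df_def mono_def)

lemma halfline_df_bounds:
  assumes "halfline_df F"
  shows "0 \<le> F x" "F x \<le> 1"
proof -
  interpret real_distribution "interval_measure F" by (rule halfline_df_real_distribution[OF assms])
  show "0 \<le> F x" "F x \<le> 1"
    using cdf_nonneg[of x] cdf_bounded_prob[of x] by (simp_all add: halfline_df_cdf[OF assms])
qed

lemma halfline_df_prob_greater:
  assumes "halfline_df F"
  shows "measure (interval_measure F) {x<..} = 1 - F x"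
proof -
  interpret real_distribution "interval_measure F" by (rule halfline_df_real_distribution[OF assms])
  have "{x<..} = space (interval_measure F) - {..x}" by auto
  hence "measure (interval_measure F) {x<..} = 1 - cdf (interval_measure F) x"
    using prob_compl[of "{..x}"] by (simp add: cdf_def)
  thus ?thesis by (simp add: halfline_df_cdf[OF assms])
qed

text \<open>The mass of \<open>{..<0}\<close> is the left limit of \<open>F\<close> at \<open>0\<close>.\<close>

lemma halfline_df_AE_nonneg:
  assumes "halfline_df F"
  shows "AE t in interval_measure F. 0 \<le> t"
proof -
  interpret real_distribution "interval_measure F" by (rule halfline_df_real_distribution[OF assms])
  have "(F \<longlongrightarrow> measure (interval_measure F) {..<0}) (at_left 0)"
    using cdf_at_left[of 0] by (simp add: halfline_df_cdf[OF assms])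
  moreover have "(F \<longlongrightarrow> 0) (at_left 0)"
  proof (rule tendsto_eventually)
    show "\<forall>\<^sub>F x in at_left 0. F x = 0"
      using assms by (auto simp: halfline_df_def eventually_at_left_field intro: exI[of _ "-1"])
  qed
  ultimately have "measure (interval_measure F) {..<0} = 0"
    by (rule tendsto_unique[rotated]) simp
  hence "AE t in interval_measure F. t \<notin> {..<0}"
    by (subst AE_iff_measurable[where N="{..<0}"]) (auto simp: emeasure_eq_measure)
  thus ?thesis by (auto simp: not_less)
qed

lemma integrable_trunc:
  assumes "halfline_df F" "\<alpha> > 0"
  shows "integrable (interval_measure F) (\<lambda>t. max 0 (min t x) powr \<alpha>)"
proof -
  interpret real_distribution "interval_measure F" by (rule halfline_df_real_distribution[OF assms(1)])
  show ?thesis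
    by (rule integrable_const_bound[where B="max 0 x powr \<alpha>"])
       (use assms(2) in \<open>auto intro!: powr_mono2\<close>)
qed

text \<open>For \<open>x \<le> y\<close> the integrand grows by \<open>y\<^sup>\<alpha> - x\<^sup>\<alpha>\<close> on \<open>t > y\<close>, by nothing on \<open>t \<le> x\<close>, and by something
  in between elsewhere. This replaces the integration by parts
  \<open>H x = \<integral>\<^sub>0\<^sup>x \<alpha> t\<^bsup>\<alpha>-1\<^esup> (1 - F t) dt\<close>: it gives differentiability of \<open>H\<close>, the
  inversion of the Williamson transform, and the growth bounds on \<open>H\<close>.\<close>

lemma trunc_moment_increment:
  assumes F: "halfline_df F" and a: "\<alpha> > 0" and xy: "0 \<le> x" "x \<le> y"
  shows "(y powr \<alpha> - x powr \<alpha>) * (1 - F y) \<le> trunc_moment \<alpha> F y - trunc_moment \<alpha> F x" (is ?A)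
    and "trunc_moment \<alpha> F y - trunc_moment \<alpha> F x \<le> (y powr \<alpha> - x powr \<alpha>) * (1 - F x)" (is ?B)
proof -
  interpret real_distribution "interval_measure F" by (rule halfline_df_real_distribution[OF F])
  let ?M = "interval_measure F"
  have ind: "integrable ?M (\<lambda>t. (y powr \<alpha> - x powr \<alpha>) * indicator {z<..} t)" 
    "(LINT t|?M. (y powr \<alpha> - x powr \<alpha>) * indicator {z<..} t) = (y powr \<alpha> - x powr \<alpha>) * (1 - F z)" for z
    using halfline_df_prob_greater[OF F, of z] by (auto simp: emeasure_eq_measure)
  have d: "trunc_moment \<alpha> F y - trunc_moment \<alpha> F x =
      (LINT t|?M. max 0 (min t y) powr \<alpha> - max 0 (min t x) powr \<alpha>)"
    unfolding trunc_moment_def using integrable_trunc[OF F a] by simp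
  have m: "s powr \<alpha> \<le> t powr \<alpha>" if "0 \<le> s" "s \<le> t" for s t
    using that a by (intro powr_mono2) auto
  show ?A unfolding d ind(2)[symmetric, of y]
    using xy by (intro integral_mono ind(1) Bochner_Integration.integrable_diff integrable_trunc[OF F a])
      (auto simp: indicator_def intro!: m)
  show ?B unfolding d ind(2)[symmetric, of x]
    using xy by (intro integral_mono ind(1) Bochner_Integration.integrable_diff integrable_trunc[OF F a])
      (auto simp: indicator_def intro!: m)
qed

lemma trunc_moment_0 [simp]: "trunc_moment \<alpha> F 0 = 0"
proof -
  have "max 0 (min t 0) = (0::real)" for t by auto
  thus ?thesis by (simp add: trunc_moment_def)
qed

lemma trunc_moment_bounds:
  assumes F: "halfline_df F" and a: "\<alpha> > 0" and x: "0 \<le> x"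
  shows "x powr \<alpha> * (1 - F x) \<le> trunc_moment \<alpha> F x" "trunc_moment \<alpha> F x \<le> x powr \<alpha>"
proof -
  show "x powr \<alpha> * (1 - F x) \<le> trunc_moment \<alpha> F x"
    using trunc_moment_increment(1)[OF F a order_refl x] by simp
  have "trunc_moment \<alpha> F x \<le> x powr \<alpha> * (1 - F 0)"
    using trunc_moment_increment(2)[OF F a order_refl x] by simp
  also have "\<dots> \<le> x powr \<alpha> * 1"
    using halfline_df_bounds[OF F] by (intro mult_left_mono) auto
  finally show "trunc_moment \<alpha> F x \<le> x powr \<alpha>" by simp
qed

lemma trunc_moment_mono:
  assumes F: "halfline_df F" and a: "\<alpha> > 0" and xy: "0 \<le> x" "x \<le> y"
  shows "trunc_moment \<alpha> F x \<le> trunc_moment \<alpha> F y"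
proof -
  have "x powr \<alpha> \<le> y powr \<alpha>" using a xy by (intro powr_mono2) auto
  hence "0 \<le> (y powr \<alpha> - x powr \<alpha>) * (1 - F y)"
    using halfline_df_bounds[OF F, of y] by simp
  thus ?thesis using trunc_moment_increment(1)[OF F a xy] by simp
qed

text \<open>The integrand on \<open>[0,x]\<close> and its extension by \<open>0\<close> beyond \<open>x\<close> are both \<open>1 - (min t x / x)\<^sup>\<alpha>\<close>, also at an
  atom \<open>t = 0\<close>.\<close>

lemma williamson_eq:
  assumes F: "halfline_df F" and a: "\<alpha> > 0" and x: "0 < x"
  shows "williamson \<alpha> F x = 1 - trunc_moment \<alpha> F x / x powr \<alpha>"
proof -
  interpret real_distribution "interval_measure F" by (rule halfline_df_real_distribution[OF F])
  let ?M = "interval_measure F"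
  have "williamson \<alpha> F x = (LINT t|?M. 1 - max 0 (min t x) powr \<alpha> / x powr \<alpha>)"
    unfolding williamson_def set_lebesgue_integral_def
    using halfline_df_AE_nonneg[OF F] x
    by (intro integral_cong_AE) (auto elim!: eventually_mono simp: indicator_def powr_divide)
  also have "\<dots> = 1 - trunc_moment \<alpha> F x / x powr \<alpha>"
    unfolding trunc_moment_def using integrable_trunc[OF F a] prob_space by simp
  finally show ?thesis .
qed

lemma trunc_moment_deriv:
  assumes F: "halfline_df F" and a: "\<alpha> > 0" and x: "0 < x" and c: "isCont F x"
  shows "(trunc_moment \<alpha> F has_real_derivative \<alpha> * x powr (\<alpha> - 1) * (1 - F x)) (at x)"
proof -
  let ?q = "\<lambda>y. (y powr \<alpha> - x powr \<alpha>) / (y - x)"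
  let ?H = "trunc_moment \<alpha> F"
  have "((\<lambda>y. y powr \<alpha>) has_real_derivative \<alpha> * x powr (\<alpha> - 1)) (at x)"
    using x by (auto intro!: derivative_eq_intros)
  hence q: "(?q \<longlongrightarrow> \<alpha> * x powr (\<alpha> - 1)) (at x)"
    by (simp add: has_field_derivative_iff)
  have Fc: "(F \<longlongrightarrow> F x) (at x)" using c by (simp add: isCont_def)
  have near: "\<forall>\<^sub>F y in at x. y > 0 \<and> y \<noteq> x"
    using x order_tendstoD(1)[OF tendsto_ident_at[of x UNIV], of 0] 
    by (auto simp: eventually_at_filter elim: eventually_mono)
  have "((\<lambda>y. (?H y - ?H x) / (y - x)) \<longlongrightarrow> \<alpha> * x powr (\<alpha> - 1) * (1 - F x)) (at x)"
  proof (rule tendsto_sandwich[where f="\<lambda>y. ?q y * (1 - max (F x) (F y))" and h="\<lambda>y. ?q y * (1 - min (F x) (F y))"])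
    have mono: "F s \<le> F t" if "s \<le> t" for s t using F that by (auto simp: halfline_df_def mono_def)
    have *: "?q y * (1 - max (F x) (F y)) \<le> (?H y - ?H x) / (y - x) \<and>
        (?H y - ?H x) / (y - x) \<le> ?q y * (1 - min (F x) (F y))" if "y > 0" "y \<noteq> x" for y
    proof (cases "x < y")
      case True
      note inc = trunc_moment_increment[OF F a less_imp_le[OF x] less_imp_le[OF True]]
      have "max (F x) (F y) = F y" "min (F x) (F y) = F x" using mono[of x y] True by auto
      thus ?thesis using inc[THEN divide_right_mono, of "y - x"] True by simp
    next
      case False
      with that have yx: "y < x" by simp
      have "(y powr \<alpha> - x powr \<alpha>) * (1 - F x) \<ge> ?H y - ?H x" "(y powr \<alpha> - x powr \<alpha>) * (1 - F y) \<le> ?H y - ?H x"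
        using trunc_moment_increment[OF F a less_imp_le[OF \<open>y > 0\<close>] less_imp_le[OF yx]]
        by (simp_all add: algebra_simps)
      note inc = this[THEN divide_right_mono_neg, of "y - x"]
      have "max (F x) (F y) = F x" "min (F x) (F y) = F y" using mono[of y x] yx by auto
      thus ?thesis using inc yx by simp
    qed
    show "\<forall>\<^sub>F y in at x. ?q y * (1 - max (F x) (F y)) \<le> (?H y - ?H x) / (y - x)"
      "\<forall>\<^sub>F y in at x. (?H y - ?H x) / (y - x) \<le> ?q y * (1 - min (F x) (F y))"
      using near * by (auto elim!: eventually_mono)
    have "((\<lambda>y. ?q y * (1 - max (F x) (F y))) \<longlongrightarrow> \<alpha> * x powr (\<alpha> - 1) * (1 - max (F x) (F x))) (at x)"
      by (intro tendsto_intros q Fc)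
    thus "((\<lambda>y. ?q y * (1 - max (F x) (F y))) \<longlongrightarrow> \<alpha> * x powr (\<alpha> - 1) * (1 - F x)) (at x)" by simp
    have "((\<lambda>y. ?q y * (1 - min (F x) (F y))) \<longlongrightarrow> \<alpha> * x powr (\<alpha> - 1) * (1 - min (F x) (F x))) (at x)"
      by (intro tendsto_intros q Fc)
    thus "((\<lambda>y. ?q y * (1 - min (F x) (F y))) \<longlongrightarrow> \<alpha> * x powr (\<alpha> - 1) * (1 - F x)) (at x)" by simp
  qed
  thus ?thesis by (simp add: has_field_derivative_iff)
qed

lemma trunc_moment_quotient_at_right:
  assumes F: "halfline_df F" and a: "\<alpha> > 0" and x: "0 < x"
  shows "((\<lambda>y. (trunc_moment \<alpha> F y - trunc_moment \<alpha> F x) / (y powr \<alpha> - x powr \<alpha>)) \<longlongrightarrow> 1 - F x) (at_right x)"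
proof (rule tendsto_sandwich[where f="\<lambda>y. 1 - F y" and h="\<lambda>y. 1 - F x"])
  let ?H = "trunc_moment \<alpha> F"
  have *: "1 - F y \<le> (?H y - ?H x) / (y powr \<alpha> - x powr \<alpha>) \<and> (?H y - ?H x) / (y powr \<alpha> - x powr \<alpha>) \<le> 1 - F x"
    if "x < y" for y
  proof -
    have "x powr \<alpha> < y powr \<alpha>" using that x a by (intro powr_less_mono2) auto
    thus ?thesis using trunc_moment_increment[OF F a, of x y] that x
      by (auto simp: field_simps)
  qed
  show "\<forall>\<^sub>F y in at_right x. 1 - F y \<le> (?H y - ?H x) / (y powr \<alpha> - x powr \<alpha>)"
    "\<forall>\<^sub>F y in at_right x. (?H y - ?H x) / (y powr \<alpha> - x powr \<alpha>) \<le> 1 - F x"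
    using * by (auto simp: eventually_at_right_field intro!: exI[of _ "x+1"])
  show "((\<lambda>y. 1 - F y) \<longlongrightarrow> 1 - F x) (at_right x)"
    using F by (intro tendsto_intros) (auto simp: halfline_df_def continuous_within)
qed simp

lemma halfline_df_eqI:
  assumes F: "halfline_df F" and G: "halfline_df G" and eq: "\<And>x. x > 0 \<Longrightarrow> F x = G x"
  shows "F = G"
proof
  fix x :: real
  consider "x > 0" | "x < 0" | "x = 0" by linarith
  thus "F x = G x"
  proof cases
    case 3
    have "(F \<longlongrightarrow> F 0) (at_right 0)" "(G \<longlongrightarrow> G 0) (at_right 0)"
      using F G by (auto simp: halfline_df_def continuous_within)
    moreover have "\<forall>\<^sub>F x in at_right 0. F x = G x"
      using eq by (auto simp: eventually_at_right_field intro!: exI[of _ 1])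
    ultimately have "F 0 = G 0"
      using tendsto_unique[of "at_right (0::real)" F "F 0" "G 0"] by (auto simp: tendsto_cong)
    thus ?thesis using 3 by simp
  qed (use eq F G in \<open>auto simp: halfline_df_def\<close>)
qed

text \<open>Inversion of the transform: the transform determines \<open>H\<close>, and the right difference quotient of \<open>H\<close> with
  respect to \<open>x\<^sup>\<alpha>\<close> recovers \<open>1 - F\<close> because \<open>F\<close> is right-continuous. This is the uniqueness that the
  description in the definition of the Kendall convolution relies on.\<close>

lemma williamson_inject:
  assumes F: "halfline_df F" and G: "halfline_df G" and a: "\<alpha> > 0"
    and eq: "\<And>x. x > 0 \<Longrightarrow> williamson \<alpha> F x = williamson \<alpha> G x"
  shows "F = G"
proof (rule halfline_df_eqI[OF F G])
  fix x :: real assume x: "x > 0"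
  have eq': "trunc_moment \<alpha> F y = trunc_moment \<alpha> G y" if "y > 0" for y
    using eq[OF that] that by (simp add: williamson_eq[OF F a that] williamson_eq[OF G a that])
  have "\<forall>\<^sub>F y in at_right x. (trunc_moment \<alpha> F y - trunc_moment \<alpha> F x) / (y powr \<alpha> - x powr \<alpha>)
      = (trunc_moment \<alpha> G y - trunc_moment \<alpha> G x) / (y powr \<alpha> - x powr \<alpha>)"
    using eq' x by (auto simp: eventually_at_right_field intro!: exI[of _ "x+1"])
  from tendsto_cong[OF this] have "1 - F x = 1 - G x"
    using trunc_moment_quotient_at_right[OF F a x] trunc_moment_quotient_at_right[OF G a x]
    by (intro tendsto_unique[of "at_right x"]) auto
  thus "F x = G x" by simp
qed

lemma powr_tendsto_0_at_right:
  assumes "\<alpha> > 0"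
  shows "((\<lambda>x. x powr \<alpha>) \<longlongrightarrow> 0) (at_right (0::real))"
proof -
  have "((\<lambda>x. x powr \<alpha>) \<longlongrightarrow> 0 powr \<alpha>) (at_right (0::real))"
    using assms by (intro tendsto_powr2 tendsto_intros)
      (auto simp: eventually_at_right_field intro!: exI[of _ 1])
  thus ?thesis by simp
qed

text \<open>The differential equation \<open>K' = \<alpha> x\<^bsup>\<alpha>-1\<^esup> (1 - F)\<close> with \<open>K(0+) = 0\<close> determines the truncated moment, which
  identifies the transform of a distribution function from the inversion formula alone.\<close>

lemma williamson_eqI:
  assumes F: "halfline_df F" and a: "\<alpha> > 0" and c: "\<And>x. x > 0 \<Longrightarrow> isCont F x"
    and K: "\<And>x. x > 0 \<Longrightarrow> (K has_real_derivative \<alpha> * x powr (\<alpha> - 1) * (1 - F x)) (at x)"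
    and K0: "(K \<longlongrightarrow> 0) (at_right 0)" and x: "x > 0"
  shows "williamson \<alpha> F x = 1 - K x / x powr \<alpha>"
proof -
  let ?D = "\<lambda>x. trunc_moment \<alpha> F x - K x"
  have "\<exists>c. \<forall>x\<in>{0<..}. ?D x = c"
  proof (rule has_field_derivative_zero_constant)
    show "(?D has_real_derivative 0) (at y within {0<..})" if "y \<in> {0<..}" for y
    proof -
      have "(?D has_real_derivative 0) (at y)"
        using DERIV_diff[OF trunc_moment_deriv[OF F a _ c] K, of y] that by simp
      thus ?thesis by (rule has_field_derivative_at_within)
    qed
  qed simp
  then obtain c where c: "\<And>y. y > 0 \<Longrightarrow> ?D y = c" by auto
  have "(trunc_moment \<alpha> F \<longlongrightarrow> 0) (at_right 0)"
  proof (rule tendsto_sandwich[where f="\<lambda>_. 0" and h="\<lambda>x. x powr \<alpha>"])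
    have "0 \<le> trunc_moment \<alpha> F y \<and> trunc_moment \<alpha> F y \<le> y powr \<alpha>" if "0 < y" for y
      using trunc_moment_mono[OF F a order_refl, of y] trunc_moment_bounds(2)[OF F a, of y] that by simp
    thus "\<forall>\<^sub>F x in at_right 0. 0 \<le> trunc_moment \<alpha> F x"
      "\<forall>\<^sub>F x in at_right 0. trunc_moment \<alpha> F x \<le> x powr \<alpha>"
      by (auto simp: eventually_at_right_field intro!: exI[of _ 1])
    show "((\<lambda>x. x powr \<alpha>) \<longlongrightarrow> 0) (at_right (0::real))"
      by (rule powr_tendsto_0_at_right[OF a])
  qed simp
  hence "(?D \<longlongrightarrow> 0 - 0) (at_right 0)" by (intro tendsto_diff K0)
  moreover have "\<forall>\<^sub>F x in at_right 0. ?D x = c"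
    using c by (auto simp: eventually_at_right_field intro!: exI[of _ 1])
  hence "(?D \<longlongrightarrow> c) (at_right 0)" by (rule tendsto_eventually)
  ultimately have "c = 0"
    using tendsto_unique[of "at_right (0::real)" ?D c "0 - 0"] by simp
  thus ?thesis using c[OF x] by (simp add: williamson_eq[OF F a x])
qed

lemma williamson_bounds:
  assumes F: "halfline_df F" and a: "\<alpha> > 0" and x: "0 < x"
  shows "0 \<le> williamson \<alpha> F x" "williamson \<alpha> F x \<le> F x"
  using trunc_moment_bounds[OF F a, of x] x
  by (simp_all add: williamson_eq[OF F a x] field_simps)

text \<open>On \<open>[x,y]\<close> the growth rate of \<open>H\<close> with respect to \<open>x\<^sup>\<alpha>\<close> is at most \<open>1 - F x\<close>, which is at most the
  average rate \<open>H x / x\<^sup>\<alpha>\<close> up to \<open>x\<close>.\<close>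

lemma williamson_mono:
  assumes F: "halfline_df F" and a: "\<alpha> > 0" and xy: "0 < x" "x \<le> y"
  shows "williamson \<alpha> F x \<le> williamson \<alpha> F y"
proof -
  let ?H = "trunc_moment \<alpha> F"
  have y: "0 < y" using xy by simp
  have le: "x powr \<alpha> \<le> y powr \<alpha>" using a xy by (intro powr_mono2) auto
  have "1 - F x \<le> ?H x / x powr \<alpha>"
    using trunc_moment_bounds(1)[OF F a, of x] xy by (simp add: field_simps)
  hence "(y powr \<alpha> - x powr \<alpha>) * (1 - F x) \<le> (y powr \<alpha> - x powr \<alpha>) * (?H x / x powr \<alpha>)"
    using le by (intro mult_left_mono) auto
  hence "?H y \<le> ?H x + (y powr \<alpha> - x powr \<alpha>) * (?H x / x powr \<alpha>)"
    using trunc_moment_increment(2)[OF F a, of x y] xy by simp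
  also have "\<dots> = y powr \<alpha> * (?H x / x powr \<alpha>)"
    using xy by (simp add: field_simps)
  finally show ?thesis
    using xy y by (simp add: williamson_eq[OF F a xy(1)] williamson_eq[OF F a y] field_simps)
qed

text \<open>Splitting the mass at \<open>sqrt x\<close>: below it \<open>(t/x)\<^sup>\<alpha>\<close> is at most \<open>x\<^bsup>-\<alpha>/2\<^esup>\<close>, above it the mass is at most
  \<open>1 - F (sqrt x)\<close>.\<close>

lemma williamson_tendsto_1:
  assumes F: "halfline_df F" and a: "\<alpha> > 0"
  shows "(williamson \<alpha> F \<longlongrightarrow> 1) at_top"
proof (rule tendsto_sandwich[where f="\<lambda>x. 1 - (x powr (- \<alpha> / 2) + (1 - F (sqrt x)))" and h="\<lambda>_. 1"])
  have *: "1 - (x powr (- \<alpha> / 2) + (1 - F (sqrt x))) \<le> williamson \<alpha> F x \<and> williamson \<alpha> F x \<le> 1" if "x \<ge> 1" for x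
  proof
    have x: "0 < x" using that by simp
    let ?z = "sqrt x"
    have z: "0 \<le> ?z" "?z \<le> x" using that real_sqrt_le_mono[of x "x * x"] by (auto simp: real_sqrt_mult)
    have zp: "?z powr \<alpha> = x powr (\<alpha> / 2)"
      using x by (simp add: powr_half_sqrt[symmetric] powr_powr)
    have "trunc_moment \<alpha> F x \<le> trunc_moment \<alpha> F ?z + (x powr \<alpha> - ?z powr \<alpha>) * (1 - F ?z)"
      using trunc_moment_increment(2)[OF F a z] by simp
    also have "\<dots> \<le> ?z powr \<alpha> + x powr \<alpha> * (1 - F ?z)"
      using trunc_moment_bounds(2)[OF F a z(1)] halfline_df_bounds[OF F, of ?z]
      by (intro add_mono mult_right_mono) auto
    finally have "trunc_moment \<alpha> F x / x powr \<alpha> \<le> (x powr (\<alpha> / 2) + x powr \<alpha> * (1 - F ?z)) / x powr \<alpha>"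
      unfolding zp by (rule divide_right_mono) simp
    also have "\<dots> = x powr (\<alpha> / 2) / x powr \<alpha> + (1 - F ?z)"
      using x by (simp add: add_divide_distrib)
    also have "x powr (\<alpha> / 2) / x powr \<alpha> = x powr (- \<alpha> / 2)"
      by (simp add: powr_diff[symmetric])
    finally show "1 - (x powr (- \<alpha> / 2) + (1 - F (sqrt x))) \<le> williamson \<alpha> F x"
      by (simp add: williamson_eq[OF F a x])
    show "williamson \<alpha> F x \<le> 1"
      using williamson_bounds(2)[OF F a x] halfline_df_bounds(2)[OF F, of x] by simp
  qed
  show "\<forall>\<^sub>F x in at_top. 1 - (x powr (- \<alpha> / 2) + (1 - F (sqrt x))) \<le> williamson \<alpha> F x"
    "\<forall>\<^sub>F x in at_top. williamson \<alpha> F x \<le> 1"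
    using * by (auto intro: eventually_at_top_linorderI[of 1])
  have "((\<lambda>x. F (sqrt x)) \<longlongrightarrow> 1) at_top"
    using F by (intro filterlim_compose[OF _ sqrt_at_top]) (simp add: halfline_df_def)
  hence "((\<lambda>x. 1 - (x powr (- \<alpha> / 2) + (1 - F (sqrt x)))) \<longlongrightarrow> 1 - (0 + (1 - 1))) at_top"
    using a by (intro tendsto_intros tendsto_neg_powr filterlim_ident) auto
  thus "((\<lambda>x. 1 - (x powr (- \<alpha> / 2) + (1 - F (sqrt x)))) \<longlongrightarrow> 1) at_top" by simp
qed simp

text \<open>Read as \<open>F = G + x G' / \<alpha>\<close>, this is the inversion formula for the Williamson transform \<open>G\<close> of \<open>F\<close>.\<close>

lemma williamson_deriv:
  assumes F: "halfline_df F" and a: "\<alpha> > 0" and x: "0 < x" and c: "isCont F x"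
  shows "(williamson \<alpha> F has_real_derivative \<alpha> / x * (F x - williamson \<alpha> F x)) (at x)"
proof -
  let ?H = "trunc_moment \<alpha> F"
  have "((\<lambda>x. 1 - ?H x / x powr \<alpha>) has_real_derivative
      (?H x * (\<alpha> * x powr (\<alpha> - 1)) - \<alpha> * x powr (\<alpha> - 1) * (1 - F x) * x powr \<alpha>) / (x powr \<alpha> * x powr \<alpha>)) (at x)"
    using x by (auto intro!: derivative_eq_intros trunc_moment_deriv[OF F a x c] simp: minus_divide_left)
  also have "(?H x * (\<alpha> * x powr (\<alpha> - 1)) - \<alpha> * x powr (\<alpha> - 1) * (1 - F x) * x powr \<alpha>) / (x powr \<alpha> * x powr \<alpha>)
     = \<alpha> / x * (F x - williamson \<alpha> F x)"
    using x by (simp add: williamson_eq[OF F a x] powr_diff field_simps)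
  finally show ?thesis
  proof (rule has_field_derivative_transform_within_open[where S="{0<..}"])
    show "1 - ?H y / y powr \<alpha> = williamson \<alpha> F y" if "y \<in> {0<..}" for y
      using that williamson_eq[OF F a, of y] by simp
  qed (use x in auto)
qed

section \<open>Kendall powers and the renewal function\<close>

lemma kendall_conv_eqI:
  assumes "\<alpha> > 0" and "halfline_df H"
    and "\<And>x. x > 0 \<Longrightarrow> williamson \<alpha> H x = williamson \<alpha> F\<^sub>1 x * williamson \<alpha> F\<^sub>2 x"
  shows "kendall_conv \<alpha> F\<^sub>1 F\<^sub>2 = H"
  unfolding kendall_conv_def using assms
  by (intro the_equality) (auto intro!: williamson_inject[of _ H \<alpha>])

lemma halfline_df_point_mass: "halfline_df (indicator {0..})"
proof -
  have "continuous (at_right a) (indicator {0..} :: real \<Rightarrow> real)" for a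
  proof (cases "a < 0")
    case True
    hence "\<forall>\<^sub>F x in at_right a. (indicator {0..} x :: real) = indicator {0..} a"
      by (auto simp: eventually_at_right_field intro!: exI[of _ 0])
    thus ?thesis unfolding continuous_within by (rule tendsto_eventually)
  next
    case False
    hence "\<forall>\<^sub>F x in at_right a. (indicator {0..} x :: real) = indicator {0..} a"
      by (auto simp: eventually_at_right_field intro!: exI[of _ "a+1"])
    thus ?thesis unfolding continuous_within by (rule tendsto_eventually)
  qed
  moreover have "((indicator {0..} :: real \<Rightarrow> real) \<longlongrightarrow> 1) at_top"
    by (rule tendsto_eventually) (auto intro: eventually_at_top_linorderI[of 0])
  ultimately show ?thesis
    by (auto simp: halfline_df_def mono_def indicator_def)
qed

lemma williamson_point_mass:
  assumes a: "\<alpha> > 0" and x: "x > 0"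
  shows "williamson \<alpha> (indicator {0..}) x = 1"
proof -
  have "isCont (indicator {0..} :: real \<Rightarrow> real) y" if "y > 0" for y :: real
  proof -
    have "\<forall>\<^sub>F z in nhds y. (indicator {0..} z :: real) = 1"
      using eventually_nhds_in_open[of "{0<..}" y] that by (auto elim: eventually_mono)
    thus ?thesis by (simp add: isCont_cong)
  qed
  hence "williamson \<alpha> (indicator {0..}) x = 1 - 0 / x powr \<alpha>"
    by (intro williamson_eqI[where K="\<lambda>_. 0"] halfline_df_point_mass a x) auto
  thus ?thesis by simp
qed

lemma power_Suc_ge_tangent:
  fixes a b :: real
  assumes "0 \<le> a" "a \<le> b"
  shows "a ^ Suc n + real (Suc n) * a ^ n * (b - a) \<le> b ^ Suc n"
proof (induction n)
  case (Suc n)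
  have "a ^ Suc (Suc n) + real (Suc (Suc n)) * a ^ Suc n * (b - a)
      = a * a ^ Suc n + a ^ Suc n * (b - a) + real (Suc n) * a ^ n * (b - a) * a"
    by (simp add: algebra_simps)
  also have "\<dots> \<le> a * a ^ Suc n + a ^ Suc n * (b - a) + real (Suc n) * a ^ n * (b - a) * b"
    using assms by (intro add_left_mono mult_left_mono) auto
  also have "\<dots> = b * (a ^ Suc n + real (Suc n) * a ^ n * (b - a))"
    by (simp add: algebra_simps)
  also have "\<dots> \<le> b * b ^ Suc n"
    using assms by (intro mult_left_mono Suc.IH) auto
  finally show ?case by simp
qed simp

text \<open>The inversion formula \<open>G + x G' / \<alpha>\<close> applied to \<open>G\<^bsup>n+1\<^esup>\<close>. It describes the Kendall power of order
  \<open>Suc n\<close>, the power of order \<open>0\<close> having an atom at the origin.\<close>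

definition kendall_power_df :: "real \<Rightarrow> (real \<Rightarrow> real) \<Rightarrow> nat \<Rightarrow> real \<Rightarrow> real" where
  "kendall_power_df \<alpha> F n x = (if x \<le> 0 then 0 else
     williamson \<alpha> F x ^ Suc n + real (Suc n) * williamson \<alpha> F x ^ n * (F x - williamson \<alpha> F x))"

lemma isCont_kendall_power_df:
  assumes F: "halfline_df F" and a: "\<alpha> > 0" and c: "isCont F x" and x: "x > 0"
  shows "isCont (kendall_power_df \<alpha> F n) x"
proof -
  have "\<forall>\<^sub>F z in nhds x. kendall_power_df \<alpha> F n z =
      williamson \<alpha> F z ^ Suc n + real (Suc n) * williamson \<alpha> F z ^ n * (F z - williamson \<alpha> F z)"
    using eventually_nhds_in_open[of "{0<..}" x] x
    by (auto elim!: eventually_mono simp: kendall_power_df_def)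
  hence "isCont (kendall_power_df \<alpha> F n) x \<longleftrightarrow> isCont (\<lambda>z.
      williamson \<alpha> F z ^ Suc n + real (Suc n) * williamson \<alpha> F z ^ n * (F z - williamson \<alpha> F z)) x"
    by (rule isCont_cong)
  moreover have "isCont (\<lambda>z. williamson \<alpha> F z ^ Suc n + real (Suc n) * williamson \<alpha> F z ^ n * (F z - williamson \<alpha> F z)) x"
    by (intro continuous_intros c DERIV_isCont[OF williamson_deriv[OF F a x c]])
  ultimately show ?thesis by simp
qed

text \<open>Monotonicity is the point: with \<open>d = F y\<close> fixed, \<open>\<psi> b = b\<^bsup>n+1\<^esup> + (n+1) b\<^sup>n (d - b)\<close> increases for \<open>0 \<le> b \<le> d\<close>,
  and \<open>G x \<le> G y \<le> F y\<close>. That \<open>\<psi>\<close> increases follows from the tangent inequality for \<open>b\<^bsup>n+1\<^esup>\<close>.\<close>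

lemma halfline_df_kendall_power_df:
  assumes F: "halfline_df F" and a: "\<alpha> > 0" and c: "continuous_on UNIV F"
  shows "halfline_df (kendall_power_df \<alpha> F n)"
proof -
  let ?G = "williamson \<alpha> F" and ?P = "kendall_power_df \<alpha> F n"
  have cF: "isCont F x" for x using c by (simp add: continuous_on_eq_continuous_at)
  note G = williamson_bounds[OF F a]
  have mF: "F x \<le> F y" if "x \<le> y" for x y using F that by (auto simp: halfline_df_def mono_def)
  have F0: "F 0 = 0"
  proof -
    have "(F \<longlongrightarrow> F 0) (at_left 0)" using cF[of 0] by (auto simp: isCont_def filterlim_at_split)
    moreover have "\<forall>\<^sub>F x in at_left 0. F x = 0"
      using F by (auto simp: eventually_at_left_field halfline_df_def intro!: exI[of _ "-1"])
    ultimately show ?thesis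
      using tendsto_unique[of "at_left (0::real)" F "F 0" 0] by (auto intro: tendsto_eventually)
  qed
  have bnd: "0 \<le> ?P x \<and> ?P x \<le> real (Suc n) * F x" if "x > 0" for x
  proof
    have "?P x = ?G x ^ n * (?G x + real (Suc n) * (F x - ?G x))"
      using that by (simp add: kendall_power_df_def algebra_simps)
    moreover have "\<dots> \<le> 1 * (?G x + real (Suc n) * (F x - ?G x))"
      using G[OF that] halfline_df_bounds(2)[OF F, of x] by (intro mult_right_mono power_le_one) auto
    moreover have "\<dots> \<le> real (Suc n) * F x"
      using G[OF that] by (simp add: algebra_simps)
    ultimately show "?P x \<le> real (Suc n) * F x" by linarith
    show "0 \<le> ?P x" using that G[OF that] by (simp add: kendall_power_df_def)
  qed
  have mono: "?P x \<le> ?P y" if "x \<le> y" for x y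
  proof (cases "x \<le> 0")
    case True
    thus ?thesis using bnd[of y] by (cases "y \<le> 0") (auto simp: kendall_power_df_def)
  next
    case False
    hence x: "0 < x" and y: "0 < y" using that by auto
    let ?a = "?G x" and ?b = "?G y"
    have ab: "0 \<le> ?a" "?a \<le> ?b" "?b \<le> F y" "F x \<le> F y"
      using G[OF x] G[OF y] williamson_mono[OF F a x that] mF[OF that] by auto
    have "?P x \<le> ?a ^ Suc n + real (Suc n) * ?a ^ n * (F y - ?a)"
      using x ab by (auto simp: kendall_power_df_def intro!: mult_left_mono)
    also have "\<dots> = (?a ^ Suc n + real (Suc n) * ?a ^ n * (?b - ?a)) + real (Suc n) * ?a ^ n * (F y - ?b)"
      by (simp add: algebra_simps)
    also have "\<dots> \<le> ?b ^ Suc n + real (Suc n) * ?b ^ n * (F y - ?b)"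
      using ab by (intro add_mono power_Suc_ge_tangent mult_right_mono mult_left_mono power_mono) auto
    also have "\<dots> = ?P y" using y by (simp add: kendall_power_df_def)
    finally show ?thesis .
  qed
  have cont: "continuous (at_right x) ?P" for x
  proof -
    consider "x < 0" | "x = 0" | "x > 0" by linarith
    thus ?thesis
    proof cases
      case 1
      hence "\<forall>\<^sub>F y in at_right x. ?P y = ?P x"
        by (auto simp: eventually_at_right_field kendall_power_df_def intro!: exI[of _ 0])
      thus ?thesis unfolding continuous_within by (rule tendsto_eventually)
    next
      case 2
      have "(?P \<longlongrightarrow> 0) (at_right 0)"
      proof (rule tendsto_sandwich[where f="\<lambda>_. 0" and h="\<lambda>x. real (Suc n) * F x"])
        show "\<forall>\<^sub>F x in at_right 0. 0 \<le> ?P x" "\<forall>\<^sub>F x in at_right 0. ?P x \<le> real (Suc n) * F x"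
          using bnd by (auto simp: eventually_at_right_field simp del: of_nat_Suc intro!: exI[of _ 1])
        have "((\<lambda>x. real (Suc n) * F x) \<longlongrightarrow> real (Suc n) * F 0) (at_right 0)"
          using F by (intro tendsto_intros) (simp add: halfline_df_def continuous_within)
        thus "((\<lambda>x. real (Suc n) * F x) \<longlongrightarrow> 0) (at_right 0)" by (simp add: F0)
      qed simp
      thus ?thesis using 2 by (simp add: continuous_within kendall_power_df_def)
    next
      case 3
      thus ?thesis using isCont_kendall_power_df[OF F a cF 3] by (rule_tac continuous_at_imp_continuous_within)
    qed
  qed
  have "((\<lambda>x. ?G x ^ Suc n + real (Suc n) * ?G x ^ n * (F x - ?G x)) \<longlongrightarrow>
      1 ^ Suc n + real (Suc n) * 1 ^ n * (1 - 1)) at_top"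
    using F by (intro tendsto_intros williamson_tendsto_1[OF F a]) (simp add: halfline_df_def)
  moreover have "\<forall>\<^sub>F x in at_top. ?P x = ?G x ^ Suc n + real (Suc n) * ?G x ^ n * (F x - ?G x)"
    using eventually_gt_at_top[of 0] by eventually_elim (simp add: kendall_power_df_def)
  ultimately have lim: "(?P \<longlongrightarrow> 1) at_top" by (simp add: tendsto_cong)
  show ?thesis
    using mono cont lim by (auto simp: halfline_df_def mono_def kendall_power_df_def)
qed

text \<open>Here \<open>K = x\<^sup>\<alpha> (1 - G\<^bsup>n+1\<^esup>)\<close> solves the differential equation that characterizes the truncated moment.
  Continuity of \<open>F\<close> makes \<open>G\<close> differentiable at every positive point.\<close>

lemma williamson_kendall_power_df:
  assumes F: "halfline_df F" and a: "\<alpha> > 0" and c: "continuous_on UNIV F" and x: "x > 0"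
  shows "williamson \<alpha> (kendall_power_df \<alpha> F n) x = williamson \<alpha> F x ^ Suc n"
proof -
  let ?G = "williamson \<alpha> F"
  have cF: "isCont F x" for x using c by (simp add: continuous_on_eq_continuous_at)
  have "williamson \<alpha> (kendall_power_df \<alpha> F n) x = 1 - (x powr \<alpha> * (1 - ?G x ^ Suc n)) / x powr \<alpha>"
  proof (rule williamson_eqI)
    show "((\<lambda>x. x powr \<alpha> * (1 - ?G x ^ Suc n)) has_real_derivative
        \<alpha> * y powr (\<alpha> - 1) * (1 - kendall_power_df \<alpha> F n y)) (at y)" if "y > 0" for y
    proof -
      have "((\<lambda>x. x powr \<alpha> * (1 - ?G x ^ Suc n)) has_real_derivative
        \<alpha> * y powr (\<alpha> - 1) * (1 - ?G y ^ Suc n) + (0 - (1 + real n) * (\<alpha> / y * (F y - ?G y) * ?G y ^ n)) * y powr \<alpha>) (at y)"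
        using that
        by (intro DERIV_mult DERIV_diff DERIV_const has_real_derivative_powr
              DERIV_power_Suc williamson_deriv[OF F a that cF]) auto
      thus ?thesis
        using that by (elim DERIV_cong) (simp add: kendall_power_df_def powr_diff field_simps)
    qed
    show "((\<lambda>x. x powr \<alpha> * (1 - ?G x ^ Suc n)) \<longlongrightarrow> 0) (at_right 0)"
    proof (rule tendsto_sandwich[where f="\<lambda>_. 0" and h="\<lambda>x. x powr \<alpha>"])
      have *: "0 \<le> ?G y ^ Suc n \<and> ?G y ^ Suc n \<le> 1" if "y > 0" for y
        using williamson_bounds[OF F a that] halfline_df_bounds(2)[OF F, of y]
        by (intro conjI power_le_one zero_le_power) auto
      have "0 \<le> y powr \<alpha> * (1 - ?G y ^ Suc n) \<and> y powr \<alpha> * (1 - ?G y ^ Suc n) \<le> y powr \<alpha>" if "y > 0" for y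
        using *[OF that] mult_left_mono[of "1 - ?G y ^ Suc n" 1 "y powr \<alpha>"] by simp
      thus "\<forall>\<^sub>F x in at_right 0. 0 \<le> x powr \<alpha> * (1 - ?G x ^ Suc n)"
        "\<forall>\<^sub>F x in at_right 0. x powr \<alpha> * (1 - ?G x ^ Suc n) \<le> x powr \<alpha>"
        by (auto simp: eventually_at_right_field simp del: power_Suc intro!: exI[of _ 1])
    qed (simp_all add: powr_tendsto_0_at_right[OF a])
  qed (use halfline_df_kendall_power_df[OF F a c] isCont_kendall_power_df[OF F a cF] a x in auto)
  thus ?thesis using x by simp
qed

lemma kendall_power_Suc_eq:
  assumes F: "halfline_df F" and a: "\<alpha> > 0" and c: "continuous_on UNIV F"
  shows "kendall_power \<alpha> F (Suc n) = kendall_power_df \<alpha> F n"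
proof (induction n)
  case 0
  show ?case
    unfolding kendall_power.simps
    by (rule kendall_conv_eqI[OF a halfline_df_kendall_power_df[OF F a c]])
       (simp add: williamson_kendall_power_df[OF F a c] williamson_point_mass[OF a])
next
  case (Suc n)
  show ?case
    unfolding kendall_power.simps(2)[of _ _ "Suc n"] Suc.IH
    by (rule kendall_conv_eqI[OF a halfline_df_kendall_power_df[OF F a c]])
       (simp add: williamson_kendall_power_df[OF F a c])
qed

text \<open>Summing \<open>G\<^sup>n + n G\<^bsup>n-1\<^esup> (F - G)\<close> over \<open>n\<close> gives \<open>1/(1-G) + (F-G)/(1-G)\<^sup>2\<close>; writing
  \<open>F - G = (1-G) - (1-F)\<close> separates the main term from a multiple of the tail.\<close>

lemma kendall_renewal_eq:
  assumes F: "halfline_df F" and a: "\<alpha> > 0" and c: "continuous_on UNIV F"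
    and x: "x > 0" and lt1: "F x < 1"
  shows "kendall_renewal \<alpha> F x = 2 / (1 - williamson \<alpha> F x) - (1 - F x) / (1 - williamson \<alpha> F x)\<^sup>2"
proof -
  define G where "G = williamson \<alpha> F x"
  have G: "0 \<le> G" "G < 1" using williamson_bounds[OF F a x] lt1 by (simp_all add: G_def)
  have "(\<lambda>n. G * G ^ n + (F x - G) * (of_nat (Suc n) * G ^ n)) sums
      (G * (1 / (1 - G)) + (F x - G) * (1 / (1 - G)^2))"
    using G by (intro sums_add sums_mult geometric_sums geometric_deriv_sums) auto
  also have "(\<lambda>n. G * G ^ n + (F x - G) * (of_nat (Suc n) * G ^ n)) = (\<lambda>n. kendall_power \<alpha> F (Suc n) x)"
    using x by (simp add: kendall_power_Suc_eq[OF F a c] kendall_power_df_def G_def algebra_simps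
      del: kendall_power.simps)
  finally have "(\<lambda>n. kendall_power \<alpha> F n x) sums
      (G * (1 / (1 - G)) + (F x - G) * (1 / (1 - G)^2) + kendall_power \<alpha> F 0 x)"
    by (subst (asm) sums_Suc_iff) simp
  hence "kendall_renewal \<alpha> F x = G * (1 / (1 - G)) + (F x - G) * (1 / (1 - G)^2) + 1"
    using x by (simp add: kendall_renewal_def sums_iff)
  also have "\<dots> = 2 / (1 - G) - (1 - F x) / (1 - G)\<^sup>2"
    using G by (simp add: divide_simps power2_eq_square) (simp add: algebra_simps)
  finally show ?thesis by (simp add: G_def)
qed

section \<open>Tails in the class \<open>\<Gamma>(g)\<close> and finite moments\<close>

text \<open>Since \<open>g x = o(x)\<close>, the point \<open>2 x\<close> eventually lies beyond \<open>x + t g x\<close> for any fixed \<open>t\<close>, where \<open>f\<close> has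
  already decreased by a factor close to \<open>e\<^bsup>-t\<^esup>\<close>.\<close>

lemma gamma_class_doubling:
  assumes f: "f \<in> gamma_class g" and anti: "\<And>x y. 0 < x \<Longrightarrow> x \<le> y \<Longrightarrow> f y \<le> f x" and s: "s > 0"
  shows "\<forall>\<^sub>F x in at_top. f (2 * x) \<le> 2 powr (- s) * f x"
proof -
  \<comment> \<open>The summand \<open>1\<close> makes \<open>exp (- t)\<close> strictly smaller than \<open>2 powr (- s)\<close>.\<close>
  define t where "t = s * ln 2 + 1"
  have t: "t > 0" using s by (simp add: t_def add_pos_pos)
  have "exp (- t) < exp (- s * ln 2)" by (simp add: t_def)
  also have "\<dots> = 2 powr (- s)" by (simp add: powr_def)
  finally have "\<forall>\<^sub>F x in at_top. f (x + t * g x) / f x < 2 powr (- s)"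
    using f by (intro order_tendstoD(2)[where y="exp (- t)"]) (auto simp: gamma_class_def)
  moreover have "\<forall>\<^sub>F x in at_top. g x / x < 1 / t"
    using f t by (intro order_tendstoD(2)[where y=0]) (auto simp: gamma_class_def)
  ultimately show ?thesis
    using eventually_gt_at_top[of 0]
  proof eventually_elim
    case (elim x)
    have pos: "f x > 0" "g x > 0" using f elim(3) by (auto simp: gamma_class_def)
    have "t * g x \<le> x" using elim(2,3) t by (simp add: field_simps)
    moreover have "0 < t * g x" using t pos by simp
    ultimately have "f (2 * x) \<le> f (x + t * g x)" using elim(3) by (intro anti) auto
    also have "\<dots> \<le> 2 powr (- s) * f x" using elim(1) pos by (simp add: field_simps)
    finally show ?case .
  qed
qed

text \<open>Iterating the doubling inequality down from \<open>x\<close> to \<open>[x\<^sub>0, 2 x\<^sub>0]\<close>. The constant \<open>(2 x\<^sub>0)\<^sup>s\<close> makes the bound at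
  least \<open>1\<close> on \<open>(0, 2 x\<^sub>0]\<close>, which takes care of the start and of small \<open>x\<close>.\<close>

lemma doubling_imp_powr_bound:
  fixes f :: "real \<Rightarrow> real"
  assumes dbl: "\<forall>\<^sub>F x in at_top. f (2 * x) \<le> 2 powr (- s) * f x"
    and le1: "\<And>x. f x \<le> 1" and s: "s > 0"
  obtains C where "C > 0" "\<And>x. x > 0 \<Longrightarrow> f x \<le> C * x powr (- s)"
proof -
  obtain x\<^sub>0 where x0: "x\<^sub>0 > 0" "\<And>x. x \<ge> x\<^sub>0 \<Longrightarrow> f (2 * x) \<le> 2 powr (- s) * f x"
  proof -
    obtain N where "\<And>x. x \<ge> N \<Longrightarrow> f (2 * x) \<le> 2 powr (- s) * f x"
      using dbl by (auto simp: eventually_at_top_linorder)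
    thus ?thesis by (intro that[of "max N 1"]) auto
  qed
  define C where "C = (2 * x\<^sub>0) powr s"
  have *: "f x \<le> C * x powr (- s)" if "0 < x" "x \<le> 2 ^ n * x\<^sub>0" for n x
    using that
  proof (induction n arbitrary: x)
    case (Suc n)
    show ?case
    proof (cases "x \<le> 2 * x\<^sub>0")
      case True
      have "1 \<le> (2 * x\<^sub>0 / x) powr s" using True Suc.prems s by (intro ge_one_powr_ge_zero) auto
      also have "\<dots> = C * x powr (- s)" using Suc.prems x0 by (simp add: C_def powr_divide powr_minus_divide)
      finally show ?thesis using le1[of x] by linarith
    next
      case False
      have "f x \<le> 2 powr (- s) * f (x / 2)" using x0(2)[of "x / 2"] False by simp
      also have "\<dots> \<le> 2 powr (- s) * (C * (x / 2) powr (- s))"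
        using Suc.prems by (intro mult_left_mono Suc.IH) auto
      also have "\<dots> = C * x powr (- s)" using Suc.prems by (simp add: powr_divide)
      finally show ?thesis .
    qed
  next
    case 0
    have "1 \<le> (2 * x\<^sub>0 / x) powr s" using 0 s x0 by (intro ge_one_powr_ge_zero) auto
    also have "\<dots> = C * x powr (- s)" using 0 x0 by (simp add: C_def powr_divide powr_minus_divide)
    finally show ?case using le1[of x] by linarith
  qed
  show ?thesis
  proof (rule that)
    show "C > 0" using x0 by (simp add: C_def)
    fix x :: real assume x: "x > 0"
    obtain n where "x / x\<^sub>0 < 2 ^ n" using real_arch_pow[of 2 "x / x\<^sub>0"] by auto
    thus "f x \<le> C * x powr (- s)" using x x0(1) by (intro *[of x n]) (auto simp: field_simps)
  qed
qed

lemma powr_bound_imp_tendsto_0: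
  fixes f :: "real \<Rightarrow> real"
  assumes "\<And>x. f x \<ge> 0" and "\<And>x. x > 0 \<Longrightarrow> f x \<le> C * x powr (- (s + 1))"
  shows "((\<lambda>x. x powr s * f x) \<longlongrightarrow> 0) at_top"
proof (rule tendsto_sandwich[where f="\<lambda>_. 0" and h="\<lambda>x. C * x powr (-1)"])
  have "x powr s * f x \<le> C * x powr (-1)" if "x > 0" for x
  proof -
    have "x powr s * f x \<le> x powr s * (C * x powr (- (s + 1)))"
      using assms(2)[OF that] by (intro mult_left_mono) auto
    also have "\<dots> = C * (x powr s * x powr (- (s + 1)))" by simp
    also have "x powr s * x powr (- (s + 1)) = x powr (-1)" by (simp add: powr_add[symmetric])
    finally show ?thesis .
  qed
  thus "\<forall>\<^sub>F x in at_top. x powr s * f x \<le> C * x powr (-1)"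
    by (rule eventually_mono[OF eventually_gt_at_top[of 0]])
  have "((\<lambda>x. C * x powr (-1)) \<longlongrightarrow> C * 0) at_top"
    by (intro tendsto_intros tendsto_neg_powr filterlim_ident) auto
  thus "((\<lambda>x. C * x powr (-1)) \<longlongrightarrow> 0) at_top" by simp
qed (use assms(1) in auto)

text \<open>Along \<open>x = 2\<^sup>n\<close> the truncated moments increase by at most a constant times \<open>2\<^bsup>n\<alpha>\<^esup> 2\<^bsup>-n(\<alpha>+1)\<^esup> = 2\<^bsup>-n\<^esup>\<close>, so they stay
  bounded and monotone convergence applies.\<close>

lemma integrable_powr_halfline:
  assumes F: "halfline_df F" and a: "\<alpha> > 0"
    and C: "C > 0" "\<And>x. x > 0 \<Longrightarrow> 1 - F x \<le> C * x powr (- (\<alpha> + 1))"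
  shows "integrable (interval_measure F) (\<lambda>t. max 0 t powr \<alpha>)"
proof -
  interpret real_distribution "interval_measure F" by (rule halfline_df_real_distribution[OF F])
  let ?H = "trunc_moment \<alpha> F"
  have step: "?H (2 ^ Suc n) - ?H (2 ^ n) \<le> 2 powr \<alpha> * C * (1 / 2) ^ n" for n
  proof -
    let ?z = "2 ^ n :: real"
    have "?H (2 * ?z) - ?H ?z \<le> ((2 * ?z) powr \<alpha> - ?z powr \<alpha>) * (1 - F ?z)"
      by (rule trunc_moment_increment(2)[OF F a]) auto
    also have "\<dots> \<le> (2 * ?z) powr \<alpha> * (1 - F ?z)"
      using halfline_df_bounds[OF F, of ?z] by (intro mult_right_mono) auto
    also have "\<dots> \<le> (2 * ?z) powr \<alpha> * (C * ?z powr (- (\<alpha> + 1)))"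
      using C by (intro mult_left_mono) auto
    also have "\<dots> = 2 powr \<alpha> * C * (?z powr \<alpha> * ?z powr (- (\<alpha> + 1)))"
      by (simp add: powr_mult)
    also have "?z powr \<alpha> * ?z powr (- (\<alpha> + 1)) = ?z powr (-1)"
      by (simp add: powr_add[symmetric])
    also have "?z powr (-1) = (1 / 2) ^ n" by (simp add: powr_minus_divide power_one_over)
    finally show ?thesis by simp
  qed
  have sum: "?H (2 ^ n) \<le> ?H 1 + 2 powr \<alpha> * C * (2 - 2 * (1 / 2) ^ n)" for n
  proof (induction n)
    case (Suc n)
    thus ?case using step[of n] by (simp add: algebra_simps)
  qed simp
  have bdd: "?H (2 ^ n) \<le> ?H 1 + 2 powr \<alpha> * C * 2" for n
  proof -
    have "2 powr \<alpha> * C * (2 - 2 * (1 / 2) ^ n) \<le> 2 powr \<alpha> * C * 2"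
      using C by (intro mult_left_mono) auto
    thus ?thesis using sum[of n] by linarith
  qed
  have inc: "incseq (\<lambda>n. ?H (2 ^ n))"
    by (intro monoI trunc_moment_mono[OF F a] power_increasing) auto
  obtain L where L: "(\<lambda>n. ?H (2 ^ n)) \<longlonglongrightarrow> L"
    using incseq_convergent[OF inc] bdd by blast
  show ?thesis
  proof (rule integrable_monotone_convergence)
    show "integrable (interval_measure F) (\<lambda>t. max 0 (min t (2 ^ n)) powr \<alpha>)" for n :: nat
      by (rule integrable_trunc[OF F a])
    show "(\<lambda>n. LINT t|interval_measure F. max 0 (min t (2 ^ n)) powr \<alpha>) \<longlonglongrightarrow> L"
      using L by (simp add: trunc_moment_def)
    show "AE t in interval_measure F. mono (\<lambda>n. max 0 (min t (2 ^ n)) powr \<alpha>)"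
    proof (rule AE_I2, rule monoI)
      fix t :: real and m n :: nat assume "m \<le> n"
      hence "(2 ^ m :: real) \<le> 2 ^ n" by simp
      hence "max 0 (min t (2 ^ m)) \<le> max 0 (min t (2 ^ n))" by linarith
      thus "max 0 (min t (2 ^ m)) powr \<alpha> \<le> max 0 (min t (2 ^ n)) powr \<alpha>"
        using a by (intro powr_mono2) auto
    qed
    show "AE t in interval_measure F. (\<lambda>n. max 0 (min t (2 ^ n)) powr \<alpha>) \<longlonglongrightarrow> max 0 t powr \<alpha>"
    proof (rule AE_I2, rule tendsto_eventually)
      fix t :: real
      obtain N where N: "t < 2 ^ N" using real_arch_pow[of 2 t] by auto
      show "\<forall>\<^sub>F n in sequentially. max 0 (min t (2 ^ n)) powr \<alpha> = max 0 t powr \<alpha>"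
      proof (rule eventually_sequentiallyI[of N])
        fix n assume "N \<le> n"
        hence "(2 ^ N :: real) \<le> 2 ^ n" by simp
        hence "min t (2 ^ n) = t" using N by linarith
        thus "max 0 (min t (2 ^ n)) powr \<alpha> = max 0 t powr \<alpha>" by simp
      qed
    qed
  qed simp
qed

lemma trunc_moment_tendsto:
  assumes F: "halfline_df F" and a: "\<alpha> > 0"
    and int: "integrable (interval_measure F) (\<lambda>t. max 0 t powr \<alpha>)"
  shows "(trunc_moment \<alpha> F \<longlongrightarrow> (LINT t|interval_measure F. max 0 t powr \<alpha>)) at_top"
  unfolding trunc_moment_def
proof (rule integral_dominated_convergence_at_top[OF _ _ int])
  show "\<forall>\<^sub>F x in at_top. AE t in interval_measure F. norm (max 0 (min t x) powr \<alpha>) \<le> max 0 t powr \<alpha>"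
    using a by (intro always_eventually allI AE_I2) (auto intro!: powr_mono2)
  show "AE t in interval_measure F. ((\<lambda>x. max 0 (min t x) powr \<alpha>) \<longlongrightarrow> max 0 t powr \<alpha>) at_top"
  proof (rule AE_I2, rule tendsto_eventually)
    fix t :: real
    show "\<forall>\<^sub>F x in at_top. max 0 (min t x) powr \<alpha> = max 0 t powr \<alpha>"
      by (rule eventually_at_top_linorderI[of t]) simp
  qed
qed auto

lemma moment_eq_integral:
  assumes "integrable (interval_measure F) (\<lambda>t. max 0 t powr \<alpha>)"
  shows "moment F \<alpha> = ennreal (LINT t|interval_measure F. max 0 t powr \<alpha>)"
proof -
  have "moment F \<alpha> = (\<integral>\<^sup>+t. ennreal (max 0 t powr \<alpha>) \<partial>interval_measure F)"
    unfolding moment_def by (intro nn_integral_cong) (auto simp: indicator_def max_def)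
  also have "\<dots> = ennreal (LINT t|interval_measure F. max 0 t powr \<alpha>)"
    using assms by (intro nn_integral_eq_integral) auto
  finally show ?thesis .
qed

section \<open>Asymptotics of the renewal increments\<close>

lemma kendall_renewal_eq_trunc_moment:
  assumes F: "halfline_df F" and a: "\<alpha> > 0" and c: "continuous_on UNIV F"
    and x: "x > 0" and lt1: "F x < 1"
  shows "kendall_renewal \<alpha> F x = 2 * x powr \<alpha> / trunc_moment \<alpha> F x
    - (1 - F x) * (x powr \<alpha>)\<^sup>2 / (trunc_moment \<alpha> F x)\<^sup>2"
  by (simp add: kendall_renewal_eq[OF assms] williamson_eq[OF F a x] power_divide)

text \<open>With \<open>H\<close> the truncated moment, \<open>R = 2 x\<^sup>\<alpha> / H - (1 - F) x\<^bsup>2\<alpha>\<^esup> / H\<^sup>2\<close>. Divided by \<open>x\<^bsup>\<alpha>-1\<^esup>\<close>, the second term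
  vanishes since the tail decays faster than any power. In the first, the increment of \<open>x\<^sup>\<alpha>\<close>
  contributes \<open>2 \<alpha> y / m\<close>, and the increment of \<open>1 / H\<close>, weighted by \<open>x\<close>, is killed by the tail.\<close>

lemma kendall_renewal_increment_tendsto:
  assumes F: "halfline_df F" and a: "\<alpha> > 0" and c: "continuous_on UNIV F"
    and lt1: "\<And>x. x > 0 \<Longrightarrow> F x < 1"
    and tail: "\<And>s. s > 0 \<Longrightarrow> ((\<lambda>x. x powr s * (1 - F x)) \<longlongrightarrow> 0) at_top"
    and H: "(trunc_moment \<alpha> F \<longlongrightarrow> m) at_top" and y: "y > 0"
  shows "((\<lambda>x. 1 / x powr (\<alpha> - 1) * (kendall_renewal \<alpha> F (x + y) - kendall_renewal \<alpha> F x))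
    \<longlongrightarrow> 2 * \<alpha> / m * y) at_top"
proof -
  let ?H = "trunc_moment \<alpha> F"
  have Hpos: "?H x > 0" if "x > 0" for x
  proof -
    have "0 < x powr \<alpha> * (1 - F x)" using that lt1[OF that] by simp
    thus ?thesis using trunc_moment_bounds(1)[OF F a, of x] that by simp
  qed
  have m: "m > 0"
  proof -
    have "?H 1 \<le> m"
    proof (rule tendsto_lowerbound[OF H])
      show "\<forall>\<^sub>F x in at_top. ?H 1 \<le> ?H x"
        by (rule eventually_at_top_linorderI[of 1]) (auto intro: trunc_moment_mono[OF F a])
    qed simp
    thus ?thesis using Hpos[of 1] by simp
  qed
  have shift: "filterlim (\<lambda>x. x + y) at_top at_top"
    by (intro filterlim_tendsto_add_at_top[OF tendsto_const filterlim_ident, of y, simplified add.commute])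
  have Hy: "((\<lambda>x. ?H (x + y)) \<longlongrightarrow> m) at_top" by (rule filterlim_compose[OF H shift])
  define D where "D = (\<lambda>x. ((x + y) powr \<alpha> - x powr \<alpha>) / x powr (\<alpha> - 1))"
  have D: "(D \<longlongrightarrow> \<alpha> * y) at_top"
    unfolding D_def using a y by real_asymp
  have ratio: "((\<lambda>x. ((x + y) / x) powr (\<alpha> - 1)) \<longlongrightarrow> 1) at_top"
    using y by real_asymp
  define E where "E = (\<lambda>x. x powr (\<alpha> + 1) * (1 - F x) / (?H x)\<^sup>2)"
  have E: "(E \<longlongrightarrow> 0) at_top"
  proof -
    have "(E \<longlongrightarrow> 0 / m\<^sup>2) at_top"
      unfolding E_def using a m by (intro tendsto_intros tail H) auto
    thus ?thesis by simp
  qed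
  have Ey: "((\<lambda>x. E (x + y)) \<longlongrightarrow> 0) at_top" by (rule filterlim_compose[OF E shift])
  have dH: "((\<lambda>x. x * (?H (x + y) - ?H x)) \<longlongrightarrow> 0) at_top"
  proof (rule tendsto_sandwich[where f="\<lambda>_. 0" and h="\<lambda>x. D x * (x powr \<alpha> * (1 - F x))"])
    show "\<forall>\<^sub>F x in at_top. 0 \<le> x * (?H (x + y) - ?H x)"
      using eventually_gt_at_top[of 0]
      by eventually_elim (use y trunc_moment_mono[OF F a] in auto)
    show "\<forall>\<^sub>F x in at_top. x * (?H (x + y) - ?H x) \<le> D x * (x powr \<alpha> * (1 - F x))"
      using eventually_gt_at_top[of 0]
    proof eventually_elim
      case (elim x)
      have "x * (?H (x + y) - ?H x) \<le> x * (((x + y) powr \<alpha> - x powr \<alpha>) * (1 - F x))"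
        using elim y by (intro mult_left_mono trunc_moment_increment(2)[OF F a]) auto
      also have "\<dots> = D x * (x powr \<alpha> * (1 - F x))"
        using elim by (simp add: D_def powr_diff)
      finally show ?case .
    qed
    have "((\<lambda>x. D x * (x powr \<alpha> * (1 - F x))) \<longlongrightarrow> \<alpha> * y * 0) at_top"
      by (intro tendsto_mult D tail a)
    thus "((\<lambda>x. D x * (x powr \<alpha> * (1 - F x))) \<longlongrightarrow> 0) at_top" by simp
  qed simp
  have "((\<lambda>x. 2 * D x / ?H (x + y) - 2 * (x * (?H (x + y) - ?H x)) / (?H (x + y) * ?H x)
      - E (x + y) * ((x + y) / x) powr (\<alpha> - 1) + E x) \<longlongrightarrow>
      2 * (\<alpha> * y) / m - 2 * 0 / (m * m) - 0 * 1 + 0) at_top"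
    using m by (intro tendsto_intros D Hy H dH E Ey ratio) auto
  also have "2 * (\<alpha> * y) / m - 2 * 0 / (m * m) - 0 * 1 + 0 = 2 * \<alpha> / m * y" by simp
  finally show ?thesis
  proof (rule Lim_transform_eventually)
    show "\<forall>\<^sub>F x in at_top. 2 * D x / ?H (x + y) - 2 * (x * (?H (x + y) - ?H x)) / (?H (x + y) * ?H x)
      - E (x + y) * ((x + y) / x) powr (\<alpha> - 1) + E x =
      1 / x powr (\<alpha> - 1) * (kendall_renewal \<alpha> F (x + y) - kendall_renewal \<alpha> F x)"
      using eventually_gt_at_top[of 0]
    proof eventually_elim
      case (elim x)
      have xy: "x + y > 0" using elim y by simp
      have h: "?H x \<noteq> 0" "?H (x + y) \<noteq> 0" using Hpos[OF elim] Hpos[OF xy] by simp_all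
      have p: "x powr (\<alpha> - 1) \<noteq> 0" "x * x powr (\<alpha> - 1) = x powr \<alpha>" using elim by (simp_all add: powr_diff)
      have e1: "E x = (1 - F x) * (x powr \<alpha>)\<^sup>2 / (?H x)\<^sup>2 / x powr (\<alpha> - 1)"
        using elim by (simp add: E_def powr_add powr_diff power2_eq_square)
      have e2: "E (x + y) * ((x + y) / x) powr (\<alpha> - 1)
          = (1 - F (x + y)) * ((x + y) powr \<alpha>)\<^sup>2 / (?H (x + y))\<^sup>2 / x powr (\<alpha> - 1)"
        using elim xy by (simp add: E_def powr_add powr_diff powr_divide power2_eq_square mult_ac)
      have aux: "2 * ((p - x * w) / w) / k - 2 * (x * (k - h)) / (k * h) = (2 * p / k - 2 * (x * w) / h) / w"
        if "w \<noteq> 0" "k \<noteq> 0" "h \<noteq> 0" for p w k h :: real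
        using that by (simp add: field_simps)
      have "2 * D x / ?H (x + y) - 2 * (x * (?H (x + y) - ?H x)) / (?H (x + y) * ?H x)
          = (2 * (x + y) powr \<alpha> / ?H (x + y) - 2 * x powr \<alpha> / ?H x) / x powr (\<alpha> - 1)"
        unfolding D_def p(2)[symmetric] by (rule aux[OF p(1) h(2,1)])
      thus ?case
        unfolding e1 e2 kendall_renewal_eq_trunc_moment[OF F a c elim lt1[OF elim]]
          kendall_renewal_eq_trunc_moment[OF F a c xy lt1[OF xy]]
        by (simp add: diff_divide_distrib algebra_simps)
    qed
  qed
qed

section \<open>Distribution functions of positive random variables\<close>

lemma halfline_df_cdf_distr:
  assumes "prob_space M" and X: "X \<in> borel_measurable M" and pos: "AE \<omega> in M. X \<omega> > 0"
  shows "halfline_df (cdf (distr M borel X))"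
proof -
  interpret prob_space M by fact
  interpret D: real_distribution "distr M borel X" using X by simp
  have "cdf (distr M borel X) x = 0" if "x < 0" for x
  proof -
    have "cdf (distr M borel X) x = prob {\<omega> \<in> space M. X \<omega> \<le> x}"
      using X by (simp add: cdf_def measure_distr vimage_def Int_def conj_commute)
    also have "\<dots> = 0"
      using pos that X by (subst prob_eq_0) (auto elim!: eventually_mono)
    finally show ?thesis .
  qed
  thus ?thesis
    using D.cdf_nondecreasing D.cdf_is_right_cont D.cdf_lim_at_top_prob
    by (auto simp: halfline_df_def mono_def)
qed

lemma interval_measure_cdf:
  assumes "real_distribution D" "halfline_df (cdf D)"
  shows "interval_measure (cdf D) = D"
  by (rule cdf_unique[OF halfline_df_real_distribution[OF assms(2)] assms(1) halfline_df_cdf[OF assms(2)]])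

lemma moment_cdf_distr:
  assumes "prob_space M" and X: "X \<in> borel_measurable M" and pos: "AE \<omega> in M. X \<omega> > 0"
  shows "moment (cdf (distr M borel X)) \<sigma> = (\<integral>\<^sup>+\<omega>. ennreal (X \<omega> powr \<sigma>) \<partial>M)"
proof -
  interpret prob_space M by fact
  have "interval_measure (cdf (distr M borel X)) = distr M borel X"
    using X by (intro interval_measure_cdf halfline_df_cdf_distr assms) auto
  hence "moment (cdf (distr M borel X)) \<sigma> = (\<integral>\<^sup>+\<omega>. ennreal (X \<omega> powr \<sigma>) * indicator {0..} (X \<omega>) \<partial>M)"
    using X by (simp add: moment_def nn_integral_distr)
  also have "\<dots> = (\<integral>\<^sup>+\<omega>. ennreal (X \<omega> powr \<sigma>) \<partial>M)"
    using pos by (intro nn_integral_cong_AE) (auto elim!: eventually_mono simp: indicator_def)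
  finally show ?thesis .
qed

theorem mainTheorem6:
  fixes M :: "'a measure" and X :: "'a \<Rightarrow> real" and F g :: "real \<Rightarrow> real" and \<alpha> :: real
  assumes "\<alpha> > 0"
    and "prob_space M"
    and "X \<in> borel_measurable M"
    and "AE \<omega> in M. X \<omega> > 0"
    and "F = cdf (distr M borel X)"
    and "continuous_on UNIV F"
    and "(\<lambda>x. 1 - F x) \<in> gamma_class g"
  shows "(\<forall>\<sigma>>0. moment F \<sigma> = (\<integral>\<^sup>+\<omega>. ennreal (X \<omega> powr \<sigma>) \<partial>M) \<and> moment F \<sigma> < \<infinity>) \<and>
    (\<forall>y>0. ((\<lambda>x. 1 / x powr (\<alpha> - 1) * (kendall_renewal \<alpha> F (x + y) - kendall_renewal \<alpha> F x))
       \<longlongrightarrow> 2 * \<alpha> / enn2real (moment F \<alpha>) * y) at_top)"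
proof -
  have F: "halfline_df F" unfolding assms(5) by (rule halfline_df_cdf_distr) fact+
  have lt1: "F x < 1" if "x > 0" for x using assms(7) that by (auto simp: gamma_class_def)
  have bound: "\<exists>C>0. \<forall>x>0. 1 - F x \<le> C * x powr (- s)" if "s > 0" for s
  proof -
    have "\<forall>\<^sub>F x in at_top. 1 - F (2 * x) \<le> 2 powr (- s) * (1 - F x)"
      using F by (intro gamma_class_doubling[OF assms(7) _ that]) (auto simp: halfline_df_def mono_def)
    thus ?thesis
    proof (rule doubling_imp_powr_bound)
      show "1 - F x \<le> 1" for x using halfline_df_bounds(1)[OF F, of x] by simp
    qed (use that in blast)+
  qed
  have int: "integrable (interval_measure F) (\<lambda>t. max 0 t powr \<sigma>)" if "\<sigma> > 0" for \<sigma>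
    using bound[of "\<sigma> + 1"] that integrable_powr_halfline[OF F that] by auto
  have tail: "((\<lambda>x. x powr s * (1 - F x)) \<longlongrightarrow> 0) at_top" if s: "s > 0" for s
  proof -
    obtain C where "\<forall>x>0. 1 - F x \<le> C * x powr (- (s + 1))" using bound[of "s + 1"] s by auto
    thus ?thesis using halfline_df_bounds(2)[OF F] by (intro powr_bound_imp_tendsto_0) auto
  qed
  have fin: "moment F \<sigma> = ennreal (LINT t|interval_measure F. max 0 t powr \<sigma>)" if "\<sigma> > 0" for \<sigma>
    by (rule moment_eq_integral[OF int[OF that]])
  have "moment F \<sigma> = (\<integral>\<^sup>+\<omega>. ennreal (X \<omega> powr \<sigma>) \<partial>M)" for \<sigma>
    using moment_cdf_distr[OF assms(2-4), of \<sigma>] by (simp add: assms(5))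
  moreover have "moment F \<sigma> < \<infinity>" if "\<sigma> > 0" for \<sigma>
    using fin[OF that] by simp
  moreover have "((\<lambda>x. 1 / x powr (\<alpha> - 1) * (kendall_renewal \<alpha> F (x + y) - kendall_renewal \<alpha> F x))
      \<longlongrightarrow> 2 * \<alpha> / enn2real (moment F \<alpha>) * y) at_top" if "y > 0" for y
  proof -
    have "enn2real (moment F \<alpha>) = (LINT t|interval_measure F. max 0 t powr \<alpha>)"
      using fin[OF assms(1)] by simp
    thus ?thesis
      using kendall_renewal_increment_tendsto[OF F assms(1,6) lt1 tail
          trunc_moment_tendsto[OF F assms(1) int[OF assms(1)]] that] by simp
  qed
  ultimately show ?thesis by blast
qed

end
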